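(* Let $q\equiv1\pmod4$ be a prime power, $n\ge3$ odd, and $Q=(q^n-1)/(q-1)$. Write $Q=k\,p_1\cdots p_s$ with $p_1,\dots,p_s$ distinct primes dividing $Q$ (and not dividing $k$), set $\delta=1-\sum_{i=1}^s1/p_i$, and assume $\delta>0$. If $$q^{\frac n2-1}>\sqrt2\Big(\frac{s-1}{\delta}+2\Big)W(k),$$ then $\mathcal{N}_0(q^n-1)>0$.
   Context: For a divisor $m$ of $q^n-1$, an element $\xi\in\mathbb{F}_{q^n}^*$ is $m$-free if $\xi=\zeta^d$ with $d\mid m$ and $\zeta\in\mathbb{F}_{q^n}^*$ implies $d=1$. $\mathcal{N}_0(m)$ is the number of $m$-free $\xi\in\mathbb{F}_{q^n}^*$ with $\mathrm{Tr}(\xi^2)=0$, where $\mathrm{Tr}(\xi)=\sum_{i=0}^{n-1}\xi^{q^i}$. $W(t)$ is the number of square-free divisors of $t$. *)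

theory Defs
  imports Complex_Main "HOL-Number_Theory.Number_Theory"
    "HOL-Computational_Algebra.Squarefree" "HOL-Library.Cardinality"
begin

text \<open>
  The type \<open>'a\<close> plays the role of the field of order \<open>q ^ n\<close>; the order is fixed by the
  assumption \<open>CARD('a) = q ^ n\<close> wherever these notions are used.
\<close>

definition m_free :: "nat \<Rightarrow> 'a::finite_field \<Rightarrow> bool" where
  "m_free m \<xi> \<longleftrightarrow>
     \<xi> \<noteq> 0 \<and> (\<forall>d \<zeta>. d dvd m \<and> \<zeta> \<noteq> 0 \<and> \<xi> = \<zeta> ^ d \<longrightarrow> d = 1)"

definition field_trace :: "nat \<Rightarrow> nat \<Rightarrow> 'a::finite_field \<Rightarrow> 'a" where
  "field_trace q n \<xi> = (\<Sum>i<n. \<xi> ^ (q ^ i))"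

definition N0 :: "'a::finite_field itself \<Rightarrow> nat \<Rightarrow> nat \<Rightarrow> nat \<Rightarrow> nat" where
  "N0 _ q n m = card {\<xi>::'a. m_free m \<xi> \<and> field_trace q n (\<xi>\<^sup>2) = 0}"

definition W :: "nat \<Rightarrow> nat" where
  "W t = card {d. d dvd t \<and> squarefree d}"

end

theory Submission
  imports Defs "HOL-Library.Real_Mod" "HOL-Computational_Algebra.Polynomial"
begin

text \<open>
  Let \<open>K\<close> be the subfield of order \<open>q\<close> and \<open>H\<close> the kernel of the trace. Since \<open>Q\<close> is odd and
  \<open>H\<close> is stable under \<open>K\<^sup>*\<close>, which is generated by the \<open>Q\<close>-th power of a primitive element, it
  suffices to find a nonzero \<open>y \<in> H\<close> that is \<open>Q\<close>-free: a suitable \<open>K\<^sup>*\<close>-multiple of \<open>y\<close> is then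
  the square of a primitive element.

  For \<open>u \<notin> K\<close> the intersection of \<open>H\<close> with its translate by \<open>u\<close> has \<open>q ^ (n - 2)\<close> elements, so
  expanding the square of the absolute value shows that a nontrivial character of
  \<open>F\<^sup>* / K\<^sup>*\<close> has a sum over \<open>H - {0}\<close> of absolute value \<open>B = (q - 1) q ^ (n / 2 - 1)\<close>.
  Sieving out one prime factor of \<open>Q\<close> at a time by characters of that prime order gives the
  number of \<open>k\<close>-free elements of \<open>H\<close> with an error controlled by the number of square-free
  divisors of \<open>k\<close>; the primes \<open>p\<^sub>i\<close> are removed by a union bound.
\<close>

section \<open>Primitive elements, roots of unity and coprimality\<close>

text \<open>The type is repackaged as a ring record, so that the theorem on cyclic multiplicative
  groups of finite fields in HOL-Algebra applies.\<close>

lemma finite_field_generator_exists: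
  "\<exists>g::'a::finite_field. g \<noteq> 0 \<and> (\<forall>x. x \<noteq> 0 \<longrightarrow> (\<exists>i::nat. x = g ^ i))"
proof -
  define R :: "'a ring" where
    "R = \<lparr>carrier = UNIV, monoid.mult = (*), one = 1, ring.zero = 0, add = (+)\<rparr>"
  have R: "carrier R = UNIV" "\<And>x y. x \<otimes>\<^bsub>R\<^esub> y = x * y" "\<one>\<^bsub>R\<^esub> = 1"
    "\<And>x y. x \<oplus>\<^bsub>R\<^esub> y = x + y" "\<zero>\<^bsub>R\<^esub> = 0"
    by (simp_all add: R_def)
  have "abelian_group R"
    by (rule abelian_groupI) (auto simp: R add.assoc add.commute intro: exI[of _ "- x" for x])
  moreover have "comm_monoid R"
    by (rule comm_monoidI) (auto simp: R mult.assoc mult.commute)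
  ultimately interpret R: cring R
    by (rule cringI) (auto simp: R algebra_simps)
  have "\<exists>y. y * x = 1" if "x \<noteq> 0" for x :: 'a
    using that left_inverse by blast
  hence "Units R = carrier R - {\<zero>\<^bsub>R\<^esub>}"
    by (auto simp: Units_def R mult.commute)
  then interpret R: field R
    by (rule R.cring_fieldI)
  have fin: "finite (carrier R)" by (simp add: R)
  obtain g where g: "g \<in> carrier (mult_of R)"
    "carrier (mult_of R) = {g [^]\<^bsub>R\<^esub> i | i::nat. i \<in> UNIV}"
    using R.finite_field_mult_group_has_gen[OF fin] by (rule bexE)
  have "g [^]\<^bsub>R\<^esub> i = g ^ i" for i :: nat
    by (induction i) (simp_all add: nat_pow_def R mult.commute)
  with g show ?thesis
    by (intro exI[of _ g]) (auto simp: R)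
qed

lemma cis_root_power_eq_1_iff:
  assumes "p > 0"
  shows "cis (2 * pi / real p) ^ m = 1 \<longleftrightarrow> p dvd m"
proof
  assume "cis (2 * pi / real p) ^ m = 1"
  hence "cis (real m * (2 * pi / real p)) = 1" by (simp only: DeMoivre)
  then obtain k :: int where "real m * (2 * pi / real p) = of_int k * (2 * pi)"
    by (auto simp: cis_eq_1_iff)
  hence "real m = of_int k * real p" using assms by (simp add: field_simps)
  hence "of_int (int m) = (of_int (k * int p) :: real)" by simp
  hence "int m = k * int p" by (simp only: of_int_eq_iff)
  thus "p dvd m" by (metis dvd_triv_right int_dvd_int_iff)
next
  assume "p dvd m"
  then obtain k where "m = p * k" by blast
  moreover have "cis (2 * pi / real p) ^ p = 1" using assms by (simp add: DeMoivre)
  ultimately show "cis (2 * pi / real p) ^ m = 1" by (simp add: power_mult)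
qed

lemma cis_root_power_cong:
  assumes "p > 0" "[i = j] (mod p)"
  shows "cis (2 * pi / real p) ^ i = cis (2 * pi / real p) ^ j"
proof -
  have "cis (2 * pi / real p) ^ i = cis (2 * pi / real p) ^ (i mod p)" for i
  proof -
    have "cis (2 * pi / real p) ^ i = cis (2 * pi / real p) ^ (p * (i div p) + i mod p)" by simp
    also have "\<dots> = cis (2 * pi / real p) ^ (i mod p)"
      unfolding power_add using assms(1) by (subst (1) cis_root_power_eq_1_iff[THEN iffD2]) simp_all
    finally show ?thesis .
  qed
  thus ?thesis using assms(2) by (metis cong_def)
qed

text \<open>Geometric series in \<open>z\<close>, whose \<open>p\<close>-th power is 1. It serves as
  the indicator of \<open>p dvd a\<close>, with \<open>a\<close> a discrete logarithm.\<close>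

lemma sum_cis_root_power:
  assumes "p > 0"
  shows "(\<Sum>j<p. cis (2 * pi / real p) ^ (j * a)) = (if p dvd a then of_nat p else 0)"
proof -
  define z where "z = cis (2 * pi / real p) ^ a"
  have z1: "z = 1 \<longleftrightarrow> p dvd a" using cis_root_power_eq_1_iff[OF assms] by (simp add: z_def)
  have zp: "z ^ p = 1"
    unfolding z_def using cis_root_power_eq_1_iff[OF assms, of "a * p"] by (simp add: power_mult)
  have "(\<Sum>j<p. cis (2 * pi / real p) ^ (j * a)) = (\<Sum>j<p. z ^ j)"
    by (simp add: z_def mult.commute flip: power_mult)
  also have "\<dots> = (if p dvd a then of_nat p else 0)"
    using z1 zp by (auto simp: geometric_sum)
  finally show ?thesis .
qed

text \<open>Sets of prime factors inject into the square-free divisors by taking products, since the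
  factorization of the product recovers the set.\<close>

lemma two_power_card_prime_factors_le_W:
  assumes "k > 0"
  shows "2 ^ card (prime_factors k) \<le> W k"
proof -
  let ?f = "\<lambda>S::nat set. prod_mset (mset_set S)"
  have pf: "prime_factorization (?f S) = mset_set S" if "S \<subseteq> prime_factors k" for S
  proof -
    have "finite S" using that finite_subset by blast
    thus ?thesis using that by (intro prime_factorization_prod_mset_primes) auto
  qed
  have nz: "?f S \<noteq> 0" if "S \<subseteq> prime_factors k" for S
    using that finite_subset[OF that] by (auto simp: prod_mset_zero_iff)
  have "inj_on ?f (Pow (prime_factors k))"
  proof (rule inj_onI)
    fix S S' assume *: "S \<in> Pow (prime_factors k)" "S' \<in> Pow (prime_factors k)" "?f S = ?f S'"
    have "prime_factorization (?f S) = prime_factorization (?f S')"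
      using *(3) by (rule arg_cong)
    moreover have "S \<subseteq> prime_factors k" "S' \<subseteq> prime_factors k" using * by auto
    ultimately have "mset_set S = mset_set S'" by (simp only: pf)
    moreover have "finite S" "finite S'" using * by (auto intro: finite_subset)
    ultimately show "S = S'" by (simp add: mset_set_eq_iff)
  qed
  moreover have "?f ` Pow (prime_factors k) \<subseteq> {d. d dvd k \<and> squarefree d}"
  proof safe
    fix S assume S: "S \<subseteq> prime_factors k"
    have "finite S" using S finite_subset by blast
    have "mset_set S \<subseteq># mset_set (prime_factors k)"
      using S by (intro subset_imp_msubset_mset_set) auto
    also have "\<dots> \<subseteq># prime_factorization k" by (rule mset_set_set_mset_msubset)
    finally have "prime_factorization (?f S) \<subseteq># prime_factorization k" by (simp only: pf[OF S])
    thus "?f S dvd k"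
      using assms nz[OF S] by (simp only: prime_factorization_subset_iff_dvd neq0_conv)
    have "multiplicity p (?f S) = 1" if "p \<in> prime_factors (?f S)" for p
    proof -
      have "count (prime_factorization (?f S)) p = 1"
        using that \<open>finite S\<close> by (simp add: pf[OF S])
      thus ?thesis using that by (simp add: count_prime_factorization in_prime_factors_iff)
    qed
    thus "squarefree (?f S)" using nz[OF S] by (simp add: squarefree_factorial_semiring')
  qed
  moreover have "finite {d. d dvd k \<and> squarefree d}"
    using finite_divisors_nat[OF assms] by (rule rev_finite_subset) auto
  ultimately have "card (Pow (prime_factors k)) \<le> card {d. d dvd k \<and> squarefree d}"
    by (rule card_inj_on_le)
  thus ?thesis by (simp add: W_def card_Pow)
qed

lemma not_coprime_common_prime:
  fixes a b :: nat
  assumes "\<not> coprime a b"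
  obtains p where "prime p" "p dvd a" "p dvd b"
proof -
  have "gcd a b \<noteq> 1" using assms coprime_iff_gcd_eq_1 by blast
  then obtain p where "prime p" "p dvd gcd a b" using prime_factor_nat by blast
  thus ?thesis by (intro that[of p]) auto
qed

text \<open>Take \<open>j\<close> to be the product of the primes of \<open>M\<close> that do not
  divide \<open>b\<close>. Each prime of \<open>M\<close> then divides exactly one of
  \<open>b\<close> and \<open>m * j\<close>.\<close>

lemma coprime_shift_exists:
  fixes b m M :: nat
  assumes "coprime b m" "M > 0"
  shows "\<exists>j. coprime (b + m * j) M"
proof -
  define j where "j = (\<Prod>p\<in>{p \<in> prime_factors M. \<not> p dvd b}. p)"
  have "coprime (b + m * j) M"
  proof (rule ccontr)
    assume "\<not> ?thesis"
    then obtain p where p: "prime p" "p dvd b + m * j" "p dvd M"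
      by (rule not_coprime_common_prime)
    show False
    proof (cases "p dvd b")
      case True
      hence "p dvd m * j" using p(2) by (simp add: dvd_add_right_iff)
      moreover have "\<not> p dvd m"
        using True p(1) assms(1) by (meson coprime_common_divisor not_prime_unit)
      ultimately have "p dvd j" using p(1) by (simp add: prime_dvd_mult_iff)
      then obtain r where r: "r \<in> prime_factors M" "\<not> r dvd b" "p dvd r"
        using p(1) by (auto simp: j_def prime_dvd_prod_iff)
      hence "p = r" using p(1) by (auto intro: primes_dvd_imp_eq)
      thus False using r True by simp
    next
      case False
      hence "p dvd j"
        unfolding j_def using p assms(2) by (intro dvd_prodI) (auto simp: in_prime_factors_iff)
      hence "p dvd b" using p(2) by (simp add: dvd_add_left_iff)
      thus False using False by simp
    qed
  qed
  thus ?thesis ..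
qed

section \<open>The Frobenius map, the subfield of order \<open>q\<close> and the trace\<close>

locale trace_kernel =
  fixes q n :: nat and g :: "'a::finite_field"
  assumes q: "primepow q" and n: "n \<ge> 2" and card: "CARD('a) = q ^ n"
    and g0: "g \<noteq> 0" and gen: "\<And>x. x \<noteq> 0 \<Longrightarrow> \<exists>i. x = g ^ i"
begin

abbreviation T :: "'a \<Rightarrow> 'a" where "T \<equiv> field_trace q n"

definition N :: nat where "N = q ^ n - 1"
definition Q :: nat where "Q = N div (q - 1)"
definition K :: "'a set" where "K = {x. x ^ q = x}"
definition H :: "'a set" where "H = {x. T x = 0}"

text \<open>Meaningful for nonzero \<open>x\<close> only. It matters only modulo \<open>N\<close>,
  so the choice of the least exponent is a convention.\<close>

definition dlog :: "'a \<Rightarrow> nat" where "dlog x = (LEAST i. x = g ^ i)"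

lemma q_gt_1: "q > 1"
  using q primepow_gt_Suc_0 by auto

lemma N_eq: "N = Q * (q - 1)"
proof -
  have "[(q - 1) + 1 = 0 + 1] (mod (q - 1))"
    by (intro cong_add) (simp_all add: cong_def)
  hence "[q ^ n = 1 ^ n] (mod (q - 1))"
    using q_gt_1 by (intro cong_pow) simp
  hence "(q - 1) dvd q ^ n - 1"
    using cong_to_1_nat by simp
  thus ?thesis by (simp add: Q_def N_def)
qed

lemma N_pos: "N > 0"
  using one_less_power[OF q_gt_1, of n] n by (simp add: N_def)

lemma Q_pos: "Q > 0"
  using N_pos N_eq by (metis mult_is_0 not_gr0)

lemma frobenius_char: "\<exists>m. q = CHAR('a) ^ m"
proof -
  obtain p k where p: "prime p" "k > 0" "q = p ^ k"
    using q by (auto simp: primepow_def)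
  have "CHAR('a) dvd p ^ (k * n)"
    using CHAR_dvd_CARD[where 'a='a] by (simp add: card p(3) power_mult)
  hence "CHAR('a) dvd p"
    using prime_dvd_power CHAR_prime by blast
  hence "CHAR('a) = p"
    using p(1) CHAR_prime primes_dvd_imp_eq by blast
  thus ?thesis using p by blast
qed

lemma frobenius_add: "(x + y :: 'a) ^ (q ^ i) = x ^ (q ^ i) + y ^ (q ^ i)"
proof -
  obtain m where "q = CHAR('a) ^ m" using frobenius_char by blast
  hence "q ^ i = CHAR('a) ^ (m * i)" by (simp add: power_mult)
  thus ?thesis by (rule freshmans_dream'[OF CHAR_prime])
qed

lemma frobenius_sum: "(sum f A :: 'a) ^ q = (\<Sum>i\<in>A. f i ^ q)"
  using frobenius_char freshmans_dream_sum'[OF CHAR_prime] by blast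

lemma K_0 [simp]: "0 \<in> K"
  using q_gt_1 by (auto simp: K_def)

lemma K_inverse: "x \<in> K \<Longrightarrow> inverse x \<in> K"
  by (simp add: K_def power_inverse)

lemma K_power: "x \<in> K \<Longrightarrow> x ^ (q ^ i) = x"
  by (induction i) (simp_all add: K_def power_mult)

lemma T_add: "T (x + y) = T x + T y"
  by (simp add: field_trace_def frobenius_add sum.distrib)

lemma T_scale: "c \<in> K \<Longrightarrow> T (c * x) = c * T x"
  by (simp add: field_trace_def power_mult_distrib K_power sum_distrib_left)

lemma T_0 [simp]: "T 0 = 0"
  using T_scale[of 0 0] by simp

lemma T_diff: "T (x - y) = T x - T y"
  using T_add[of "x - y" y] by (simp add: algebra_simps)

text \<open>Raising to the power \<open>q\<close> shifts the summands by one place, and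
  \<open>x ^ (q ^ n) = x\<close> closes the cycle. Adding \<open>x\<close> to both sides makes them
  the same sum of \<open>n + 1\<close> terms.\<close>

lemma T_in_K: "T x \<in> K"
proof -
  have "T x ^ q = (\<Sum>i<n. x ^ (q ^ Suc i))"
    by (simp add: field_trace_def frobenius_sum mult.commute flip: power_mult)
  also have "\<dots> + x ^ (q ^ 0) = (\<Sum>i<Suc n. x ^ (q ^ i))"
    by (simp only: sum.lessThan_Suc_shift add.commute)
  also have "\<dots> = T x + x"
    using finite_field_power_card_eq_same[of x] by (simp add: field_trace_def card)
  finally show ?thesis by (simp add: K_def)
qed

text \<open>The trace is a polynomial function of degree at most \<open>q ^ (n - 1)\<close>, too
  small to vanish at all \<open>q ^ n\<close> elements.\<close>

lemma T_nonzero: "\<exists>x. T x \<noteq> 0"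
proof (rule ccontr)
  assume *: "\<not> ?thesis"
  define P :: "'a poly" where "P = (\<Sum>i<n. Polynomial.monom 1 (q ^ i))"
  have "poly P x = T x" for x
    by (simp add: P_def poly_sum poly_monom field_trace_def)
  hence roots: "{x. poly P x = 0} = UNIV" using * by auto
  \<comment> \<open>Only the summand \<open>i = 0\<close> has degree 1, so the linear coefficient
    shows that \<open>P\<close> is not zero.\<close>
  have "poly.coeff P 1 = (\<Sum>i<n. if i = 0 then 1 else 0)"
    unfolding P_def coeff_sum using q_gt_1 by (intro sum.cong) (auto simp: coeff_monom)
  also have "\<dots> = 1" using n by simp
  finally have "P \<noteq> 0" by auto
  have "Polynomial.degree P \<le> q ^ (n - 1)"
    unfolding P_def
  proof (rule degree_sum_le)
    fix i assume "i \<in> {..<n}"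
    thus "Polynomial.degree (Polynomial.monom (1::'a) (q ^ i)) \<le> q ^ (n - 1)"
      using q_gt_1 by (auto simp: Polynomial.degree_monom_eq intro!: power_increasing)
  qed simp
  moreover have "q ^ n \<le> Polynomial.degree P"
    using card_poly_roots_bound[OF \<open>P \<noteq> 0\<close>] by (simp add: roots card)
  moreover have "q ^ (n - 1) < q ^ n"
    using q_gt_1 n by (intro power_strict_increasing) auto
  ultimately show False by linarith
qed

lemma T_nondegenerate:
  assumes "w \<noteq> 0" shows "\<exists>x. T (w * x) \<noteq> 0"
proof -
  obtain x where "T x \<noteq> 0" using T_nonzero by blast
  thus ?thesis using assms by (intro exI[of _ "inverse w * x"]) (simp flip: mult.assoc)
qed

section \<open>Discrete logarithms to the base \<open>g\<close>\<close>

lemma g_power_N: "g ^ N = 1"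
proof -
  have "q ^ n = Suc N" using q_gt_1 by (simp add: N_def)
  hence "g ^ N * g = g"
    using finite_field_power_card_eq_same[of g] by (simp add: card mult.commute)
  thus ?thesis using g0 by simp
qed

lemma g_power_mod: "g ^ (i mod N) = g ^ i"
proof -
  have "g ^ i = g ^ (i mod N + N * (i div N))" by simp
  also have "\<dots> = g ^ (i mod N)" by (simp only: power_add power_mult g_power_N) simp
  finally show ?thesis by simp
qed

lemma nonzero_eq_image: "UNIV - {0} = (\<lambda>i. g ^ i) ` {..<N}"
proof (intro equalityI subsetI)
  fix x assume "x \<in> UNIV - {0 :: 'a}"
  then obtain i where "x = g ^ i" using gen by auto
  thus "x \<in> (\<lambda>i. g ^ i) ` {..<N}"
    using N_pos by (intro image_eqI[of _ _ "i mod N"]) (simp_all add: g_power_mod)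
qed (use g0 in auto)

lemma inj_on_g_power: "inj_on (\<lambda>i. g ^ i) {..<N}"
proof (rule eq_card_imp_inj_on)
  show "card ((\<lambda>i. g ^ i) ` {..<N}) = card {..<N}"
    unfolding nonzero_eq_image[symmetric] by (simp add: card N_def)
qed simp

lemma g_power_eq_iff: "g ^ i = g ^ j \<longleftrightarrow> [i = j] (mod N)"
proof
  assume "g ^ i = g ^ j"
  hence "g ^ (i mod N) = g ^ (j mod N)" by (simp add: g_power_mod)
  thus "[i = j] (mod N)"
    using inj_on_g_power N_pos by (auto simp: inj_on_def cong_def)
next
  assume "[i = j] (mod N)"
  thus "g ^ i = g ^ j" by (metis cong_def g_power_mod)
qed

lemma g_power_dlog: "x \<noteq> 0 \<Longrightarrow> g ^ dlog x = x"
  unfolding dlog_def using LeastI_ex[OF gen[of x]] by simp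

lemma dlog_g_power: "[dlog (g ^ i) = i] (mod N)"
  using g_power_dlog[of "g ^ i"] g0 by (simp add: g_power_eq_iff)

lemma dlog_mult:
  assumes "x \<noteq> 0" "y \<noteq> 0"
  shows "[dlog (x * y) = dlog x + dlog y] (mod N)"
proof -
  have "g ^ dlog (x * y) = g ^ (dlog x + dlog y)"
    using assms by (simp add: g_power_dlog power_add)
  thus ?thesis by (simp only: g_power_eq_iff)
qed

text \<open>Being fixed by Frobenius means that \<open>N = Q * (q - 1)\<close> divides
  \<open>i * (q - 1)\<close>. So the nonzero elements of \<open>K\<close> are the powers of
  \<open>g ^ Q\<close>.\<close>

lemma g_power_in_K_iff: "g ^ i \<in> K \<longleftrightarrow> Q dvd i"
proof -
  have "i * q = i * (q - 1) + i" using q_gt_1 by (cases q) auto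
  hence "(g ^ i) ^ q = g ^ (i * (q - 1)) * g ^ i"
    by (simp only: power_mult[symmetric] power_add)
  hence "g ^ i \<in> K \<longleftrightarrow> g ^ (i * (q - 1)) * g ^ i = g ^ i"
    by (simp add: K_def)
  also have "\<dots> \<longleftrightarrow> g ^ (i * (q - 1)) = g ^ 0"
    using g0 by simp
  also have "\<dots> \<longleftrightarrow> Q * (q - 1) dvd i * (q - 1)"
    unfolding g_power_eq_iff cong_0_iff N_eq ..
  also have "\<dots> \<longleftrightarrow> Q dvd i" using q_gt_1 by simp
  finally show ?thesis .
qed

lemma K_nonzero: "K - {0} = (\<lambda>j. g ^ (Q * j)) ` {..<q - 1}"
proof (intro equalityI subsetI)
  fix x assume x: "x \<in> K - {0}"
  then obtain i where i: "i < N" "x = g ^ i" using nonzero_eq_image by blast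
  with x obtain j where "i = Q * j" by (auto simp: g_power_in_K_iff)
  with i show "x \<in> (\<lambda>j. g ^ (Q * j)) ` {..<q - 1}" by (auto simp: N_eq)
qed (use g0 in \<open>auto simp: g_power_in_K_iff\<close>)

lemma card_K_nonzero: "card (K - {0}) = q - 1"
proof -
  have "inj_on (\<lambda>j. g ^ (Q * j)) {..<q - 1}"
  proof (rule inj_onI)
    fix i j assume ij: "i \<in> {..<q - 1}" "j \<in> {..<q - 1}" "g ^ (Q * i) = g ^ (Q * j)"
    hence "Q * i = Q * j"
      using Q_pos by (intro inj_onD[OF inj_on_g_power]) (simp_all add: N_eq)
    thus "i = j" using Q_pos by simp
  qed
  thus ?thesis unfolding K_nonzero by (simp add: card_image)
qed

lemma card_K: "card K = q"
proof -
  have "card K = Suc (card (K - {0}))" by (rule card.remove) simp_all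
  thus ?thesis unfolding card_K_nonzero using q_gt_1 by simp
qed

section \<open>Trace-zero hyperplanes and their intersections\<close>

text \<open>Rank-nullity by counting: scale \<open>x1\<close> to \<open>x0\<close> with
  \<open>f x0 = 1\<close>. Every \<open>v\<close> in \<open>V\<close> is then uniquely a kernel
  element plus \<open>f v * x0\<close>.\<close>

lemma card_functional_kernel:
  fixes V :: "'a set" and f :: "'a \<Rightarrow> 'a"
  assumes add: "\<And>x y. x \<in> V \<Longrightarrow> y \<in> V \<Longrightarrow> x + y \<in> V"
    and diff: "\<And>x y. x \<in> V \<Longrightarrow> y \<in> V \<Longrightarrow> x - y \<in> V"
    and scale: "\<And>c x. c \<in> K \<Longrightarrow> x \<in> V \<Longrightarrow> c * x \<in> V"
    and f_add: "\<And>x y. f (x + y) = f x + f y"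
    and f_scale: "\<And>c x. c \<in> K \<Longrightarrow> f (c * x) = c * f x"
    and f_K: "\<And>x. f x \<in> K"
    and x1: "x1 \<in> V" "f x1 \<noteq> 0"
  shows "card {x \<in> V. f x = 0} * q = card V"
proof -
  define x0 where "x0 = inverse (f x1) * x1"
  have x0: "x0 \<in> V" "f x0 = 1"
    using x1 f_K by (auto simp: x0_def f_scale K_inverse intro!: scale)
  have f_diff: "f (x - y) = f x - f y" for x y
    using f_add[of "x - y" y] by (simp add: algebra_simps)
  have "bij_betw (\<lambda>(x, c). x + c * x0) ({x \<in> V. f x = 0} \<times> K) V"
    by (rule bij_betw_byWitness[where f' = "\<lambda>v. (v - f v * x0, f v)"])
       (auto simp: f_add f_diff f_scale f_K x0 intro!: add diff scale)
  thus ?thesis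
    using bij_betw_same_card by (fastforce simp: card_cartesian_product card_K)
qed

lemma card_H: "card H = q ^ (n - 1)"
proof -
  obtain x where "T x \<noteq> 0" using T_nonzero by blast
  hence "card H * q = q ^ n"
    using card_functional_kernel[of UNIV T x] by (simp add: H_def T_add T_scale T_in_K card)
  also have "\<dots> = q ^ (n - 1) * q" using n by (simp flip: power_Suc2)
  finally show ?thesis using q_gt_1 by simp
qed

text \<open>If \<open>T (u * x)\<close> vanished on all of \<open>H\<close>, it would be
  \<open>c * T x\<close> for some \<open>c\<close> in \<open>K\<close>, and nondegeneracy would give
  \<open>u = c\<close>. So it is a nonzero functional on \<open>H\<close>, whose kernel has index
  \<open>q\<close>.\<close>

lemma card_H_inter:
  assumes "u \<notin> K"
  shows "card {x \<in> H. T (u * x) = 0} = q ^ (n - 2)"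
proof -
  have "\<exists>x\<in>H. T (u * x) \<noteq> 0"
  proof (rule ccontr)
    assume *: "\<not> ?thesis"
    obtain x1 where x1: "T x1 \<noteq> 0" using T_nonzero by blast
    define x0 where "x0 = inverse (T x1) * x1"
    have x0: "T x0 = 1" using x1 by (simp add: x0_def T_scale K_inverse T_in_K)
    define c where "c = T (u * x0)"
    have "c \<in> K" by (simp add: c_def T_in_K)
    have "T ((u - c) * x) = 0" for x
    proof -
      \<comment> \<open>Projection of \<open>x\<close> to \<open>H\<close> along
        \<open>x0\<close>.\<close>
      have "x - T x * x0 \<in> H"
        by (simp add: H_def T_diff T_scale T_in_K x0)
      hence "T (u * (x - T x * x0)) = 0" using * by blast
      moreover have "u * (x - T x * x0) = u * x - T x * (u * x0)" by (simp add: algebra_simps)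
      ultimately have "T (u * x) = T x * c" by (simp add: T_diff T_scale T_in_K c_def)
      thus ?thesis using \<open>c \<in> K\<close> by (simp add: left_diff_distrib T_diff T_scale)
    qed
    hence "u - c = 0" using T_nondegenerate by blast
    thus False using \<open>c \<in> K\<close> assms by simp
  qed
  then obtain x1 where "x1 \<in> H" "T (u * x1) \<noteq> 0" by blast
  hence "card {x \<in> H. T (u * x) = 0} * q = card H"
    by (intro card_functional_kernel[where f = "\<lambda>x. T (u * x)"])
       (auto simp: H_def T_add T_diff T_scale T_in_K distrib_left mult.left_commute[of u])
  also have "\<dots> = q ^ Suc (n - 2)" using n by (simp add: card_H Suc_diff_Suc numeral_2_eq_2)
  also have "\<dots> = q ^ (n - 2) * q" by simp
  finally show ?thesis using q_gt_1 by simp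
qed


section \<open>Character sums over the trace-zero hyperplane\<close>

text \<open>These are the characters of the unit group modulo the nonzero elements of
  \<open>K\<close>. The value at 0 is arbitrary, as all sums run over nonzero elements.\<close>

definition K_char :: "('a \<Rightarrow> complex) \<Rightarrow> bool" where
  "K_char \<chi> \<longleftrightarrow> (\<forall>x y. x \<noteq> 0 \<longrightarrow> y \<noteq> 0 \<longrightarrow> \<chi> (x * y) = \<chi> x * \<chi> y) \<and>
     (\<forall>x. x \<noteq> 0 \<longrightarrow> norm (\<chi> x) = 1) \<and> (\<forall>c\<in>K. c \<noteq> 0 \<longrightarrow> \<chi> c = 1)"

lemma K_char_mult: "K_char \<chi> \<Longrightarrow> K_char \<chi>' \<Longrightarrow> K_char (\<lambda>x. \<chi> x * \<chi>' x)"
  by (simp add: K_char_def norm_mult)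

text \<open>The substitution of \<open>a * x\<close> for \<open>x\<close> multiplies the sum by
  \<open>\<chi> a\<close>, which is not 1.\<close>

lemma K_char_sum_nonzero:
  assumes \<chi>: "K_char \<chi>" and a: "a \<noteq> 0" "\<chi> a \<noteq> 1"
  shows "(\<Sum>x\<in>UNIV-{0}. \<chi> x) = 0"
proof -
  have "(\<Sum>x\<in>UNIV-{0}. \<chi> x) = (\<Sum>x\<in>UNIV-{0}. \<chi> (a * x))"
    by (rule sum.reindex_bij_witness[of _ "\<lambda>x. a * x" "\<lambda>x. x / a"]) (use a in auto)
  also have "\<dots> = \<chi> a * (\<Sum>x\<in>UNIV-{0}. \<chi> x)"
    using \<chi> a by (simp add: K_char_def sum_distrib_left)
  finally show ?thesis using a by (simp add: mult_cancel_right1)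
qed

text \<open>Written as a constant plus a correction on \<open>K\<close>, because the constant
  cancels against a nontrivial character.\<close>

lemma card_H_inter_nonzero:
  assumes "u \<noteq> 0"
  shows "real (card {y \<in> H - {0}. T (u * y) = 0}) =
    (real q ^ (n - 2) - 1) + (if u \<in> K then real q ^ (n - 1) - real q ^ (n - 2) else 0)"
proof -
  have "{y \<in> H - {0}. T (u * y) = 0} = {y \<in> H. T (u * y) = 0} - {0}" by auto
  moreover have "0 \<in> {y \<in> H. T (u * y) = 0}" by (simp add: H_def)
  ultimately have "card {y \<in> H - {0}. T (u * y) = 0} = card {y \<in> H. T (u * y) = 0} - 1"
    by (simp only: card_Diff_singleton)
  moreover have "card {y \<in> H. T (u * y) = 0} = (if u \<in> K then q ^ (n - 1) else q ^ (n - 2))"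
  proof (cases "u \<in> K")
    case True
    hence "{y \<in> H. T (u * y) = 0} = H" by (auto simp: H_def T_scale)
    thus ?thesis using True card_H by simp
  qed (simp add: card_H_inter)
  moreover have "q ^ m \<ge> 1" for m using q_gt_1 by simp
  ultimately show ?thesis by (simp add: of_nat_diff)
qed

text \<open>The trace-zero hyperplane modulo \<open>K\<^sup>*\<close> is Singer's difference set, so its nontrivial
  character sums all have the same modulus.\<close>

lemma norm_K_char_sum_H:
  assumes \<chi>: "K_char \<chi>" and a: "a \<noteq> 0" "\<chi> a \<noteq> 1"
  shows "norm (\<Sum>x\<in>H-{0}. \<chi> x) = (real q - 1) * sqrt (real q ^ (n - 2))"
proof -
  define S where "S = (\<Sum>x\<in>H-{0}. \<chi> x)"
  have mult: "\<chi> (x * y) = \<chi> x * \<chi> y" if "x \<noteq> 0" "y \<noteq> 0" for x y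
    using \<chi> that by (simp add: K_char_def)
  have unit: "\<chi> y * cnj (\<chi> y) = 1" if "y \<noteq> 0" for y
    using \<chi> that by (simp add: K_char_def complex_norm_square[symmetric])
  have "S * cnj S = (\<Sum>y\<in>H-{0}. \<Sum>x\<in>H-{0}. \<chi> x * cnj (\<chi> y))"
    unfolding S_def cnj_sum sum_product by (rule sum.swap)
  \<comment> \<open>For fixed \<open>y\<close> put \<open>u = x / y\<close>: the product of
    character values becomes \<open>\<chi> u\<close>, and membership of \<open>x\<close> in
    \<open>H\<close> becomes \<open>T (u * y) = 0\<close>.\<close>
  also have "\<dots> = (\<Sum>y\<in>H-{0}. \<Sum>u\<in>UNIV-{0}. if T (u * y) = 0 then \<chi> u else 0)"
  proof (rule sum.cong[OF refl])
    fix y assume y: "y \<in> H - {0}"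
    have "(\<Sum>u\<in>UNIV-{0}. if T (u * y) = 0 then \<chi> u else 0) = (\<Sum>u | u \<noteq> 0 \<and> T (u * y) = 0. \<chi> u)"
      by (subst sum.inter_filter[symmetric]) (auto intro!: sum.cong)
    also have "\<dots> = (\<Sum>x\<in>H-{0}. \<chi> x * cnj (\<chi> y))"
    proof (rule sum.reindex_bij_witness[of _ "\<lambda>x. x / y" "\<lambda>u. u * y"])
      fix u assume "u \<in> {u. u \<noteq> 0 \<and> T (u * y) = 0}"
      thus "\<chi> (u * y) * cnj (\<chi> y) = \<chi> u"
        using y unit[of y] by (simp add: mult mult.assoc)
    qed (use y in \<open>auto simp: H_def\<close>)
    finally show "(\<Sum>x\<in>H-{0}. \<chi> x * cnj (\<chi> y)) =
      (\<Sum>u\<in>UNIV-{0}. if T (u * y) = 0 then \<chi> u else 0)" by simp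
  qed
  also have "\<dots> = (\<Sum>u\<in>UNIV-{0}. \<Sum>y\<in>H-{0}. if T (u * y) = 0 then \<chi> u else 0)"
    by (rule sum.swap)
  also have "\<dots> = (\<Sum>u\<in>UNIV-{0}. of_real (real (card {y \<in> H - {0}. T (u * y) = 0})) * \<chi> u)"
    by (intro sum.cong refl) (simp add: sum.inter_filter[symmetric])
  also have "\<dots> = (\<Sum>u\<in>UNIV-{0}. of_real (real q ^ (n - 2) - 1) * \<chi> u +
      (if u \<in> K then of_real (real q ^ (n - 1) - real q ^ (n - 2)) else 0))"
  proof (rule sum.cong[OF refl])
    fix u :: 'a assume u: "u \<in> UNIV - {0}"
    hence "\<chi> u = 1" if "u \<in> K" using that \<chi> by (auto simp: K_char_def)
    with u show "of_real (real (card {y \<in> H - {0}. T (u * y) = 0})) * \<chi> u =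
      of_real (real q ^ (n - 2) - 1) * \<chi> u +
      (if u \<in> K then of_real (real q ^ (n - 1) - real q ^ (n - 2)) else 0)"
      by (subst card_H_inter_nonzero) (auto simp: algebra_simps)
  qed
  \<comment> \<open>Orthogonality removes the constant part, leaving only the \<open>q - 1\<close>
    nonzero elements of \<open>K\<close>.\<close>
  also have "\<dots> = (\<Sum>u\<in>UNIV-{0}. if u \<in> K then of_real (real q ^ (n - 1) - real q ^ (n - 2)) else 0)"
    unfolding sum.distrib sum_distrib_left[symmetric] using K_char_sum_nonzero[OF \<chi> a] by simp
  also have "\<dots> = (\<Sum>u\<in>{u \<in> UNIV - {0}. u \<in> K}. of_real (real q ^ (n - 1) - real q ^ (n - 2)))"
    by (rule sum.inter_filter[symmetric]) simp
  also have "{u \<in> UNIV - {0}. u \<in> K} = K - {0}" by auto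
  also have "(\<Sum>u\<in>K-{0}. complex_of_real (real q ^ (n - 1) - real q ^ (n - 2))) =
      of_nat (q - 1) * of_real (real q ^ (n - 1) - real q ^ (n - 2))"
    unfolding sum_constant card_K_nonzero ..
  also have "\<dots> = of_real ((real q - 1) * (real q ^ (n - 1) - real q ^ (n - 2)))"
    using q_gt_1 by (simp add: of_nat_diff)
  also have "real q ^ (n - 1) = real q ^ Suc (n - 2)"
    using n by (simp add: Suc_diff_Suc numeral_2_eq_2)
  also have "(real q - 1) * (real q ^ Suc (n - 2) - real q ^ (n - 2)) =
      (real q - 1)\<^sup>2 * real q ^ (n - 2)"
    by (simp add: power2_eq_square algebra_simps)
  finally have "complex_of_real ((norm S)\<^sup>2) = of_real ((real q - 1)\<^sup>2 * real q ^ (n - 2))"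
    by (simp only: complex_norm_square)
  hence "(norm S)\<^sup>2 = (real q - 1)\<^sup>2 * real q ^ (n - 2)"
    by (simp only: of_real_eq_iff)
  hence "norm S = sqrt ((real q - 1)\<^sup>2 * real q ^ (n - 2))"
    by (metis norm_ge_zero real_sqrt_unique)
  thus ?thesis using q_gt_1 by (simp add: real_sqrt_mult S_def)
qed

section \<open>Characters of prime order and the sieve by characters\<close>

text \<open>For a prime \<open>p\<close> dividing \<open>Q\<close> and \<open>j < p\<close> these
  are all the characters of order dividing \<open>p\<close>; \<open>j = 0\<close> gives the trivial
  one.\<close>

definition residue_char :: "nat \<Rightarrow> nat \<Rightarrow> 'a \<Rightarrow> complex" where
  "residue_char p j x = cis (2 * pi / real p) ^ (j * dlog x)"

text \<open>Multiplicativity holds because \<open>p\<close> divides \<open>N\<close>, the modulus of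
  \<open>dlog\<close>. Triviality on \<open>K\<close> holds because logarithms there are multiples
  of \<open>Q\<close>.\<close>

lemma K_char_residue_char:
  assumes "p dvd Q" shows "K_char (residue_char p j)"
proof -
  have p: "p > 0" using assms Q_pos by (auto intro: Nat.gr0I)
  have "p dvd N" using assms by (simp add: N_eq)
  have "residue_char p j (x * y) = residue_char p j x * residue_char p j y"
    if "x \<noteq> 0" "y \<noteq> 0" for x y
  proof -
    have "[dlog (x * y) = dlog x + dlog y] (mod p)"
      using dlog_mult[OF that] \<open>p dvd N\<close> by (rule cong_dvd_modulus_nat)
    hence "[j * dlog (x * y) = j * dlog x + j * dlog y] (mod p)"
      unfolding distrib_left[symmetric] by (rule cong_mult[OF cong_refl])
    thus ?thesis
      unfolding residue_char_def power_add[symmetric] by (rule cis_root_power_cong[OF p])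
  qed
  moreover have "residue_char p j c = 1" if "c \<in> K" "c \<noteq> 0" for c
  proof -
    have "Q dvd dlog c" using that g_power_dlog[of c] by (simp flip: g_power_in_K_iff)
    hence "p dvd j * dlog c" using assms by (meson dvd_mult dvd_trans)
    thus ?thesis unfolding residue_char_def by (simp add: cis_root_power_eq_1_iff[OF p])
  qed
  ultimately show ?thesis by (simp add: K_char_def residue_char_def norm_power)
qed

text \<open>For a prime \<open>p\<close> dividing \<open>Q\<close>, a nonzero \<open>x\<close> is \<open>p\<close>-free iff \<open>p\<close> does not divide
  \<open>dlog x\<close>.\<close>

definition free_sum :: "nat set \<Rightarrow> ('a \<Rightarrow> complex) \<Rightarrow> complex" where
  "free_sum P \<chi> = (\<Sum>x\<in>H-{0}. if \<forall>p\<in>P. \<not> p dvd dlog x then \<chi> x else 0)"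

definition free_count :: "nat set \<Rightarrow> nat" where
  "free_count P = card {x \<in> H - {0}. \<forall>p\<in>P. \<not> p dvd dlog x}"

text \<open>For a set of primes with product \<open>m\<close> this is \<open>phi(m) / m\<close>, the
  expected proportion of \<open>m\<close>-free elements.\<close>

definition \<theta> :: "nat set \<Rightarrow> real" where "\<theta> P = (\<Prod>p\<in>P. 1 - 1 / real p)"

definition B :: real where "B = (real q - 1) * sqrt (real q ^ (n - 2))"

lemma B_nonneg: "B \<ge> 0"
  using q_gt_1 by (simp add: B_def)

lemma free_sum_one: "free_sum P (\<lambda>_. 1) = of_nat (free_count P)"
  unfolding free_sum_def free_count_def by (subst sum.inter_filter[symmetric]) auto

text \<open>The condition that \<open>p\<close> does not divide \<open>dlog x\<close> has indicator
  1 minus the mean of \<open>residue_char p j x\<close> over \<open>j < p\<close>. The term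
  \<open>j = 0\<close> is split off and joins the main term.\<close>

lemma free_sum_insert:
  assumes p: "p > 0"
  shows "free_sum (insert p P) \<chi> = of_real (1 - 1 / real p) * free_sum P \<chi> -
    of_real (1 / real p) * (\<Sum>j\<in>{1..<p}. free_sum P (\<lambda>x. \<chi> x * residue_char p j x))"
proof -
  let ?F = "\<lambda>x. \<forall>p\<in>P. \<not> p dvd dlog x"
  have "(if \<forall>r\<in>insert p P. \<not> r dvd dlog x then \<chi> x else 0) =
     of_real (1 - 1 / real p) * (if ?F x then \<chi> x else 0) -
     of_real (1 / real p) * (\<Sum>j\<in>{1..<p}. if ?F x then \<chi> x * residue_char p j x else 0)" for x
  proof (cases "?F x")
    case True
    have "{..<p} = insert 0 {1..<p}" using p by auto
    hence "(\<Sum>j<p. residue_char p j x) = 1 + (\<Sum>j\<in>{1..<p}. residue_char p j x)"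
      by (simp add: residue_char_def)
    hence *: "(\<Sum>j\<in>{1..<p}. residue_char p j x) = (if p dvd dlog x then of_nat p else 0) - 1"
      using sum_cis_root_power[OF p, of "dlog x"] by (simp add: residue_char_def)
    have **: "(\<Sum>j\<in>{1..<p}. if ?F x then \<chi> x * residue_char p j x else 0) =
        \<chi> x * ((if p dvd dlog x then of_nat p else 0) - 1)"
      unfolding *[symmetric] sum_distrib_left using True by simp
    show ?thesis unfolding ** using True p by (auto simp: field_simps)
  next
    case False
    hence F: "?F x = False" "(\<forall>r\<in>insert p P. \<not> r dvd dlog x) = False" by blast+
    show ?thesis unfolding F by simp
  qed
  hence "free_sum (insert p P) \<chi> =
     of_real (1 - 1 / real p) * free_sum P \<chi> -
     of_real (1 / real p) * (\<Sum>x\<in>H-{0}. \<Sum>j\<in>{1..<p}. if ?F x then \<chi> x * residue_char p j x else 0)"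
    unfolding free_sum_def by (simp only: sum_subtractf sum_distrib_left)
  also have "(\<Sum>x\<in>H-{0}. \<Sum>j\<in>{1..<p}. if ?F x then \<chi> x * residue_char p j x else 0) =
     (\<Sum>j\<in>{1..<p}. free_sum P (\<lambda>x. \<chi> x * residue_char p j x))"
    unfolding free_sum_def by (rule sum.swap)
  finally show ?thesis .
qed

text \<open>Since \<open>dlog g\<close> is 1 modulo \<open>p\<close>, the value at \<open>g\<close>
  has exact order \<open>p\<close>. This makes \<open>g\<close> a witness that a product of
  characters of coprime orders is nontrivial.\<close>

lemma residue_char_power_g:
  assumes "prime p" "p dvd Q" "j \<in> {1..<p}" "\<not> p dvd m"
  shows "residue_char p j g ^ m \<noteq> 1"
proof
  assume "residue_char p j g ^ m = 1"
  hence "p dvd j * dlog g * m"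
    using cis_root_power_eq_1_iff[of p "j * dlog g * m"] prime_gt_0_nat[OF assms(1)]
    by (simp add: residue_char_def power_mult)
  moreover have "\<not> p dvd j" using assms(3) by (auto dest: dvd_imp_le)
  moreover have "\<not> p dvd dlog g"
  proof -
    have "p dvd N" using assms(2) by (simp add: N_eq)
    hence "[dlog g = 1] (mod p)" using dlog_g_power[of 1] cong_dvd_modulus_nat by simp
    thus ?thesis using assms(1) cong_dvd_iff not_prime_unit by blast
  qed
  ultimately show False using assms(1,4) by (simp add: prime_dvd_mult_iff)
qed

lemma residue_char_power_self:
  assumes "p > 0" shows "residue_char p j x ^ p = 1"
  using cis_root_power_eq_1_iff[OF assms, of "j * dlog x * p"]
  by (simp add: residue_char_def power_mult)

lemma norm_sum_residue_le:
  assumes "p > 0" "\<And>j. j \<in> {1..<p} \<Longrightarrow> norm (f j) \<le> (C::real)"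
  shows "norm (of_real (1 / real p) * (\<Sum>j\<in>{1..<p}. f j :: complex)) \<le> (1 - 1 / real p) * C"
proof -
  have "norm (\<Sum>j\<in>{1..<p}. f j) \<le> (\<Sum>j\<in>{1..<p}. C)"
    by (rule sum_norm_le) (use assms in auto)
  also have "\<dots> = (real p - 1) * C" using assms(1) by (simp add: of_nat_diff)
  finally have "norm (\<Sum>j\<in>{1..<p}. f j) / real p \<le> (real p - 1) * C / real p"
    by (rule divide_right_mono) simp
  thus ?thesis using assms(1) by (simp add: norm_mult norm_divide field_simps)
qed

lemma \<theta>_insert: "finite P \<Longrightarrow> p \<notin> P \<Longrightarrow> \<theta> (insert p P) = (1 - 1 / real p) * \<theta> P"
  by (simp add: \<theta>_def)

text \<open>Inserting \<open>p\<close> leaves \<open>\<chi>\<close> with weight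
  \<open>1 - 1 / p\<close> and adds \<open>p - 1\<close> twists of weight \<open>1 / p\<close>, so
  the bound grows by the factor \<open>2 * (1 - 1 / p)\<close>. The exponent \<open>m\<close>
  annihilates \<open>\<chi>\<close> and is prime to \<open>P\<close>, which keeps the twists
  nontrivial; a twist has exponent \<open>m * p\<close>.\<close>

lemma norm_free_sum_le:
  assumes "finite P" "\<And>p. p \<in> P \<Longrightarrow> prime p \<and> p dvd Q"
    and "K_char \<chi>" "a \<noteq> 0" "\<chi> a \<noteq> 1"
    and "\<And>x. x \<noteq> 0 \<Longrightarrow> \<chi> x ^ m = 1" "\<And>p. p \<in> P \<Longrightarrow> \<not> p dvd m"
  shows "norm (free_sum P \<chi>) \<le> \<theta> P * 2 ^ card P * B"
  using assms
proof (induction P arbitrary: \<chi> a m rule: finite_induct)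
  case empty
  thus ?case using norm_K_char_sum_H[of \<chi> a] by (simp add: free_sum_def \<theta>_def B_def)
next
  case (insert p P)
  have p: "prime p" "p dvd Q" "p > 0" "\<not> p dvd m"
    using insert.prems by (auto intro: prime_gt_0_nat)
  let ?C = "\<theta> P * 2 ^ card P * B"
  have 1: "norm (free_sum P \<chi>) \<le> ?C"
    by (rule insert.IH) (use insert.prems in auto)
  have 2: "norm (free_sum P (\<lambda>x. \<chi> x * residue_char p j x)) \<le> ?C" if j: "j \<in> {1..<p}" for j
  proof -
    have "\<chi> g * residue_char p j g \<noteq> 1"
    proof
      assume "\<chi> g * residue_char p j g = 1"
      \<comment> \<open>The \<open>m\<close>-th power removes \<open>\<chi>\<close>, but not the
        factor of order \<open>p\<close>.\<close>
      hence "\<chi> g ^ m * residue_char p j g ^ m = 1" by (simp flip: power_mult_distrib)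
      thus False
        using residue_char_power_g[OF p(1,2) j p(4)] insert.prems(5)[OF g0] by simp
    qed
    moreover have "(\<chi> x * residue_char p j x) ^ (m * p) = 1" if "x \<noteq> 0" for x
    proof -
      have "(\<chi> x * residue_char p j x) ^ (m * p) = (\<chi> x ^ m) ^ p * (residue_char p j x ^ p) ^ m"
        unfolding power_mult_distrib power_mult[symmetric] by (simp only: mult.commute)
      thus ?thesis using insert.prems(5)[OF that] residue_char_power_self[OF p(3)] by simp
    qed
    moreover have "\<not> r dvd m * p" if "r \<in> P" for r
    proof -
      have "prime r" "\<not> r dvd m" "r \<noteq> p" using that insert.prems insert.hyps by auto
      thus ?thesis using p(1) primes_dvd_imp_eq prime_dvd_mult_iff by blast
    qed
    ultimately show ?thesis
      using insert.prems K_char_residue_char[OF p(2)] g0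
      by (intro insert.IH[where a = g and m = "m * p"]) (auto intro: K_char_mult g0)
  qed
  have "norm (free_sum (insert p P) \<chi>) \<le> norm (of_real (1 - 1 / real p) * free_sum P \<chi>) +
    norm (of_real (1 / real p) * (\<Sum>j\<in>{1..<p}. free_sum P (\<lambda>x. \<chi> x * residue_char p j x)))"
    unfolding free_sum_insert[OF p(3)] by (rule norm_triangle_ineq4)
  also have "\<dots> \<le> (1 - 1 / real p) * ?C + (1 - 1 / real p) * ?C"
  proof (rule add_mono)
    have "norm (of_real (1 - 1 / real p) * free_sum P \<chi>) = (1 - 1 / real p) * norm (free_sum P \<chi>)"
      using p(3) unfolding norm_mult norm_of_real by simp
    thus "norm (of_real (1 - 1 / real p) * free_sum P \<chi>) \<le> (1 - 1 / real p) * ?C"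
      using 1 p(3) by (simp add: mult_left_mono)
  qed (rule norm_sum_residue_le[OF p(3) 2])
  also have "\<dots> = \<theta> (insert p P) * 2 ^ card (insert p P) * B"
    using insert.hyps by (simp add: \<theta>_insert)
  finally show ?case .
qed

text \<open>The count is the free sum of the trivial character, so the error consists of the
  \<open>p - 1\<close> nontrivial residue characters, each covered by
  \<open>norm_free_sum_le\<close>.\<close>

lemma free_count_insert:
  assumes "finite P" "\<And>r. r \<in> P \<Longrightarrow> prime r \<and> r dvd Q" "prime p" "p dvd Q" "p \<notin> P"
  shows "\<bar>real (free_count (insert p P)) - (1 - 1 / real p) * real (free_count P)\<bar>
    \<le> (1 - 1 / real p) * (\<theta> P * 2 ^ card P * B)"
proof -
  have p: "p > 0" using assms(3) by (rule prime_gt_0_nat)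
  have "norm (free_sum P (\<lambda>x. 1 * residue_char p j x)) \<le> \<theta> P * 2 ^ card P * B" if "j \<in> {1..<p}" for j
  proof (rule norm_free_sum_le[where a = g and m = p])
    show "1 * residue_char p j g \<noteq> 1"
      using residue_char_power_g[OF assms(3,4) that, of 1] prime_gt_1_nat[OF assms(3)] by simp
    show "\<not> r dvd p" if "r \<in> P" for r
      using that assms primes_dvd_imp_eq by blast
    show "K_char (\<lambda>x. 1 * residue_char p j x)"
      using K_char_residue_char[OF assms(4)] by simp
    show "(1 * residue_char p j x) ^ p = 1" for x
      using residue_char_power_self[OF p] by simp
  qed (use assms(1,2) g0 in auto)
  from norm_sum_residue_le[OF p this]
  have "norm (free_sum (insert p P) (\<lambda>_. 1) - of_real (1 - 1 / real p) * free_sum P (\<lambda>_. 1))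
      \<le> (1 - 1 / real p) * (\<theta> P * 2 ^ card P * B)"
    unfolding free_sum_insert[OF p] by simp
  also have "free_sum (insert p P) (\<lambda>_. 1) - of_real (1 - 1 / real p) * free_sum P (\<lambda>_. 1) =
     of_real (real (free_count (insert p P)) - (1 - 1 / real p) * real (free_count P))"
    unfolding free_sum_one by simp
  finally show ?thesis unfolding norm_of_real .
qed

lemma \<theta>_pos: "(\<And>p. p \<in> P \<Longrightarrow> prime p) \<Longrightarrow> \<theta> P > 0"
  unfolding \<theta>_def
proof (rule prod_pos)
  fix p assume "\<And>p. p \<in> P \<Longrightarrow> prime p" "p \<in> P"
  hence "real p > 1" using prime_gt_1_nat by simp
  thus "1 - 1 / real p > 0" by simp
qed

text \<open>Induction over the primes, starting from the exact count for the empty set. Each new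
  prime adds an error with factor \<open>w = 2 ^ card P\<close> to the old one with
  \<open>w - 1\<close>, which gives \<open>2 * w - 1\<close>.\<close>

lemma free_count_approx:
  assumes "finite P" "\<And>p. p \<in> P \<Longrightarrow> prime p \<and> p dvd Q"
  shows "\<bar>real (free_count P) - \<theta> P * (real q ^ (n - 1) - 1)\<bar> \<le> \<theta> P * (2 ^ card P - 1) * B"
  using assms
proof (induction P rule: finite_induct)
  case empty
  have "0 \<in> H" by (simp add: H_def)
  hence "card (H - {0}) = q ^ (n - 1) - 1" by (simp add: card_H)
  moreover have "q ^ (n - 1) \<ge> 1" using q_gt_1 by simp
  moreover have "free_count {} = card (H - {0})" unfolding free_count_def by (rule arg_cong[where f = card]) auto
  ultimately show ?case by (simp add: \<theta>_def of_nat_diff)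
next
  case (insert p P)
  let ?t = "1 - 1 / real p" and ?M = "real q ^ (n - 1) - 1"
  have p: "prime p" "p dvd Q" "p > 0"
    using insert.prems by (auto intro: prime_gt_0_nat)
  have "?t * \<bar>real (free_count P) - \<theta> P * ?M\<bar> \<le> ?t * (\<theta> P * (2 ^ card P - 1) * B)"
    using p(3) insert by (intro mult_left_mono insert.IH) auto
  hence "\<bar>?t * real (free_count P) - ?t * (\<theta> P * ?M)\<bar> \<le> ?t * (\<theta> P * (2 ^ card P - 1) * B)"
    using p(3) by (simp add: abs_mult flip: right_diff_distrib)
  moreover have "\<bar>real (free_count (insert p P)) - ?t * real (free_count P)\<bar>
      \<le> ?t * (\<theta> P * 2 ^ card P * B)"
    by (rule free_count_insert) (use insert p in auto)
  ultimately have "\<bar>real (free_count (insert p P)) - ?t * (\<theta> P * ?M)\<bar>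
      \<le> ?t * (\<theta> P * 2 ^ card P * B) + ?t * (\<theta> P * (2 ^ card P - 1) * B)"
    by linarith
  also have "\<dots> = \<theta> (insert p P) * (2 ^ card (insert p P) - 1) * B"
  proof -
    have "t * (a * w * b) + t * (a * (w - 1) * b) = t * a * (2 * w - 1) * b" for t a w b :: real
      by (simp add: algebra_simps)
    thus ?thesis using insert.hyps by (simp add: \<theta>_insert)
  qed
  finally show ?case using insert.hyps by (simp add: \<theta>_insert mult.assoc)
qed

text \<open>Union bound: an element that survives \<open>P0\<close> but not
  \<open>P0 \<union> P\<close> is already lost on inserting some single \<open>p\<close> of
  \<open>P\<close>.\<close>

lemma free_count_sieve:
  assumes "finite P"
  shows "real (free_count P0) \<le> real (free_count (P0 \<union> P)) +
    (\<Sum>p\<in>P. real (free_count P0) - real (free_count (insert p P0)))"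
proof -
  let ?A = "\<lambda>P. {x \<in> H - {0}. \<forall>p\<in>P. \<not> p dvd dlog x}"
  have diff: "real (card (?A P0 - ?A (insert p P0))) =
      real (free_count P0) - real (free_count (insert p P0))" for p
  proof -
    have "?A (insert p P0) \<subseteq> ?A P0" by auto
    hence "card (?A P0 - ?A (insert p P0)) + card (?A (insert p P0)) = card (?A P0)"
      by (subst card_Diff_subset) (auto intro!: le_add_diff_inverse2 card_mono)
    thus ?thesis unfolding free_count_def by linarith
  qed
  have "?A P0 \<subseteq> ?A (P0 \<union> P) \<union> (\<Union>p\<in>P. ?A P0 - ?A (insert p P0))" by blast
  hence "card (?A P0) \<le> card (?A (P0 \<union> P) \<union> (\<Union>p\<in>P. ?A P0 - ?A (insert p P0)))"
    by (intro card_mono) auto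
  also have "\<dots> \<le> card (?A (P0 \<union> P)) + card (\<Union>p\<in>P. ?A P0 - ?A (insert p P0))"
    by (rule card_Un_le)
  also have "\<dots> \<le> card (?A (P0 \<union> P)) + (\<Sum>p\<in>P. card (?A P0 - ?A (insert p P0)))"
    by (intro add_left_mono card_UN_le assms)
  finally have "real (card (?A P0)) \<le> real (card (?A (P0 \<union> P)) + (\<Sum>p\<in>P. card (?A P0 - ?A (insert p P0))))"
    by (simp only: of_nat_le_iff)
  thus ?thesis by (simp only: of_nat_add of_nat_sum diff free_count_def[symmetric])
qed


section \<open>From \<open>Q\<close>-free elements to primitive square roots\<close>

lemma Q_eq_sum: "Q = (\<Sum>i<n. q ^ i)"
proof -
  have "(q - 1) * (\<Sum>i<m. q ^ i) + 1 = q ^ m" for m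
  proof (induction m)
    case (Suc m)
    have "(q - 1) * (\<Sum>i<Suc m. q ^ i) + 1 = (q - 1) * q ^ m + ((q - 1) * (\<Sum>i<m. q ^ i) + 1)"
      by (simp add: algebra_simps)
    also have "\<dots> = ((q - 1) + 1) * q ^ m" unfolding Suc by simp
    finally show ?case using q_gt_1 by simp
  qed simp
  from this[of n] have "N = (q - 1) * (\<Sum>i<n. q ^ i)" by (simp add: N_def)
  thus ?thesis using q_gt_1 by (simp add: Q_def)
qed

lemma odd_Q:
  assumes "odd q" "odd n" shows "odd Q"
proof -
  have "even (\<Sum>i<m. q ^ i) \<longleftrightarrow> even m" for m
    using assms(1) by (induction m) auto
  thus ?thesis using assms(2) by (simp add: Q_eq_sum)
qed

text \<open>Multiplying by powers of \<open>g ^ Q\<close>, a generator of \<open>K\<^sup>*\<close>, preserves both the trace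
  condition and \<open>Q\<close>-freeness. Since \<open>Q\<close> is odd, one such multiplication makes the element a
  square, and further ones make its square root primitive.\<close>

lemma m_free_exists:
  assumes "odd Q" and y: "y \<in> H - {0}" "\<And>p. p \<in> prime_factors Q \<Longrightarrow> \<not> p dvd dlog y"
  shows "\<exists>\<xi>. m_free N \<xi> \<and> T (\<xi>\<^sup>2) = 0"
proof -
  \<comment> \<open>As \<open>Q\<close> is odd, adding it changes the parity; on the field side this
    multiplies \<open>y\<close> by \<open>g ^ Q\<close>, an element of \<open>K\<close>.\<close>
  define a where "a = (if even (dlog y) then dlog y else dlog y + Q)"
  have "even a" using assms(1) by (simp add: a_def)
  then obtain b where b: "a = 2 * b" by blast
  have cop: "coprime (dlog y) Q"
  proof (rule ccontr)
    assume "\<not> ?thesis"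
    then obtain p where "prime p" "p dvd dlog y" "p dvd Q"
      by (rule not_coprime_common_prime)
    thus False using y(2)[of p] Q_pos by (simp add: in_prime_factors_iff)
  qed
  hence "coprime a Q" unfolding a_def coprime_iff_gcd_eq_1 by simp
  hence "coprime b Q" by (simp add: b)
  \<comment> \<open>An exponent coprime to \<open>N\<close> makes \<open>\<xi>\<close> primitive.
    The shift by \<open>Q * j\<close> only multiplies the square root by an element of
    \<open>K\<close>.\<close>
  then obtain j where j: "coprime (b + Q * j) N"
    using coprime_shift_exists N_pos by blast
  define \<xi> where "\<xi> = g ^ (b + Q * j)"
  have "m_free N \<xi>"
    unfolding m_free_def
  proof (intro conjI allI impI)
    fix d \<zeta> assume *: "d dvd N \<and> \<zeta> \<noteq> 0 \<and> \<xi> = \<zeta> ^ d"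
    hence "g ^ (b + Q * j) = g ^ (dlog \<zeta> * d)"
      by (simp add: \<xi>_def power_mult g_power_dlog)
    hence "[b + Q * j = dlog \<zeta> * d] (mod N)" by (simp only: g_power_eq_iff)
    hence "[b + Q * j = dlog \<zeta> * d] (mod d)" using * cong_dvd_modulus_nat by blast
    hence "d dvd b + Q * j" by (simp add: cong_dvd_iff)
    thus "d = 1" using j * coprime_common_divisor_nat by blast
  qed (simp add: \<xi>_def g0)
  moreover have "T (\<xi>\<^sup>2) = 0"
  proof -
    \<comment> \<open>The exponent of the factor in \<open>K\<close> relating \<open>y\<close> to
      the square of \<open>\<xi>\<close>, hence a multiple of \<open>Q\<close> in both
      cases.\<close>
    define e where "e = (if even (dlog y) then Q * (2 * j) else Q * (2 * j + 1))"
    have "\<xi>\<^sup>2 = g ^ ((b + Q * j) * 2)" by (simp only: \<xi>_def power_mult)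
    also have "(b + Q * j) * 2 = e + dlog y"
      using b by (simp add: a_def e_def algebra_simps split: if_splits)
    also have "g ^ (e + dlog y) = g ^ e * y" using y(1) by (simp add: power_add g_power_dlog)
    finally have "\<xi>\<^sup>2 = g ^ e * y" .
    moreover have "g ^ e \<in> K" by (simp add: g_power_in_K_iff e_def)
    ultimately show ?thesis using y(1) by (simp add: T_scale H_def)
  qed
  ultimately show ?thesis by blast
qed

section \<open>Positivity from the two sieves\<close>

text \<open>The primes in \<open>P0\<close> are sieved by characters at the cost of a factor
  \<open>2 ^ card P0\<close>, those in \<open>P\<close> by the union bound. Multiplied by
  \<open>B\<close>, the hypothesis bounds the total error by the main term \<open>M\<close> and
  leaves \<open>B\<close> to spare.\<close>

lemma free_count_pos:
  fixes P P0 :: "nat set" and \<delta> :: real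
  assumes fin: "finite P0" "finite P" and disj: "P \<inter> P0 = {}"
    and primes: "\<And>p. p \<in> P0 \<union> P \<Longrightarrow> prime p \<and> p dvd Q"
    and \<delta>: "\<delta> = 1 - (\<Sum>p\<in>P. 1 / real p)" "\<delta> > 0"
    and bound: "sqrt (real q ^ (n - 2)) > ((real (card P) - 1) / \<delta> + 2) * 2 ^ card P0"
  shows "free_count (P0 \<union> P) > 0"
proof -
  define w :: real where "w = 2 ^ card P0"
  define s where "s = real (card P)"
  define C0 where "C0 = real (free_count P0)"
  define M where "M = real q ^ (n - 1) - 1"
  define r where "r = sqrt (real q ^ (n - 2))"
  define E where "E = \<theta> P0 * w * B"
  have \<theta>: "\<theta> P0 > 0" using primes by (intro \<theta>_pos) auto
  have r: "r > 0" using q_gt_1 by (simp add: r_def)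
  have step: "C0 - real (free_count (insert p P0)) \<le> (1 / real p) * C0 + (1 - 1 / real p) * E"
    if "p \<in> P" for p
  proof -
    have "\<bar>real (free_count (insert p P0)) - (1 - 1 / real p) * C0\<bar> \<le> (1 - 1 / real p) * E"
      unfolding C0_def E_def w_def
      by (rule free_count_insert) (use that fin primes disj in auto)
    moreover have "(1 - 1 / real p) * C0 = C0 - (1 / real p) * C0" by (simp add: algebra_simps)
    ultimately show ?thesis by linarith
  qed
  have "C0 \<le> real (free_count (P0 \<union> P)) + (\<Sum>p\<in>P. C0 - real (free_count (insert p P0)))"
    unfolding C0_def by (rule free_count_sieve[OF fin(2)])
  also have "(\<Sum>p\<in>P. C0 - real (free_count (insert p P0))) \<le>
      (\<Sum>p\<in>P. (1 / real p) * C0 + (1 - 1 / real p) * E)"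
    by (intro sum_mono step)
  \<comment> \<open>The reciprocals over \<open>P\<close> add up to \<open>1 - \<delta>\<close>, so
    the complementary weights add up to \<open>s - 1 + \<delta>\<close>.\<close>
  also have "\<dots> = (1 - \<delta>) * C0 + (s - 1 + \<delta>) * E"
    unfolding sum.distrib sum_distrib_right[symmetric] sum_subtractf by (simp add: \<delta>(1) s_def)
  finally have Cs: "real (free_count (P0 \<union> P)) \<ge> \<delta> * C0 - (s - 1 + \<delta>) * E"
    by (simp add: algebra_simps)
  have "\<bar>C0 - \<theta> P0 * M\<bar> \<le> \<theta> P0 * (w - 1) * B"
    unfolding C0_def M_def w_def by (rule free_count_approx) (use fin primes in auto)
  hence "C0 \<ge> \<theta> P0 * M - \<theta> P0 * (w - 1) * B" by linarith
  hence "\<delta> * C0 \<ge> \<delta> * (\<theta> P0 * M - \<theta> P0 * (w - 1) * B)"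
    using \<delta>(2) by (intro mult_left_mono) auto
  with Cs have "real (free_count (P0 \<union> P)) \<ge>
      \<delta> * (\<theta> P0 * M - \<theta> P0 * (w - 1) * B) - (s - 1 + \<delta>) * E"
    by linarith
  \<comment> \<open>Of the 2 in the hypothesis, one unit comes from the error in \<open>C0\<close>
    and one from the \<open>\<delta>\<close> in \<open>s - 1 + \<delta>\<close>. The
    \<open>- 1\<close> in \<open>w - 1\<close> yields the extra \<open>B\<close>.\<close>
  also have "\<delta> * (\<theta> P0 * M - \<theta> P0 * (w - 1) * B) - (s - 1 + \<delta>) * E =
      \<theta> P0 * \<delta> * (M + B - B * (((s - 1) / \<delta> + 2) * w))"
    unfolding E_def using \<delta>(2) by (simp add: field_simps)
  finally have lower: "real (free_count (P0 \<union> P)) \<ge>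
      \<theta> P0 * \<delta> * (M + B - B * (((s - 1) / \<delta> + 2) * w))" .
  have "B * (((s - 1) / \<delta> + 2) * w) \<le> B * r"
    using bound B_nonneg by (intro mult_left_mono) (simp_all add: s_def w_def r_def)
  also have "B * r = (real q - 1) * real q ^ (n - 2)"
    by (simp add: B_def r_def)
  also have "\<dots> = real q ^ Suc (n - 2) - real q ^ (n - 2)" by (simp add: algebra_simps)
  also have "Suc (n - 2) = n - 1" using n by simp
  also have "real q ^ (n - 1) - real q ^ (n - 2) \<le> M" using q_gt_1 by (simp add: M_def)
  finally have "B * (((s - 1) / \<delta> + 2) * w) \<le> M" .
  moreover have "B > 0" using q_gt_1 r by (simp add: B_def r_def)
  ultimately have "M + B - B * (((s - 1) / \<delta> + 2) * w) > 0" by linarith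
  hence "\<theta> P0 * \<delta> * (M + B - B * (((s - 1) / \<delta> + 2) * w)) > 0"
    using \<theta> \<delta>(2) by simp
  with lower show ?thesis by linarith
qed

end

section \<open>Passage from the numerical hypothesis to a primitive element\<close>

theorem theorem5p15:
  fixes q n Q k s :: nat and p :: "nat \<Rightarrow> nat" and \<delta> :: real
  assumes "primepow q" and "[q = 1] (mod 4)"
    and "n \<ge> 3" and "odd n"
    and "CARD('a::finite_field) = q ^ n"
    and "Q = (q ^ n - 1) div (q - 1)"
    and "Q = k * (\<Prod>i=1..s. p i)"
    and "inj_on p {1..s}"
    and "\<And>i. i \<in> {1..s} \<Longrightarrow> prime (p i) \<and> p i dvd Q \<and> \<not> p i dvd k"
    and "\<delta> = 1 - (\<Sum>i=1..s. 1 / real (p i))" and "\<delta> > 0"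
    and "real q powr (real n / 2 - 1) > sqrt 2 * ((real s - 1) / \<delta> + 2) * real (W k)"
  shows "N0 TYPE('a) q n (q ^ n - 1) > 0"
proof -
  obtain g :: 'a where g: "g \<noteq> 0" "\<And>x. x \<noteq> 0 \<Longrightarrow> \<exists>i. x = g ^ i"
    using finite_field_generator_exists by blast
  interpret F: trace_kernel q n g
    by unfold_locales (use assms g in auto)
  have Q: "Q = F.Q" by (simp add: assms(6) F.Q_def F.N_def)
  have "odd q" using assms(2) cong_dvd_modulus_nat[of q 1 4 2] by (simp add: cong_dvd_iff)
  hence "odd F.Q" using assms(4) by (rule F.odd_Q)
  have k: "k > 0" using F.Q_pos assms(7) by (auto simp: Q intro: Nat.gr0I)
  define P where "P = p ` {1..s}"
  have card_P: "card P = s" unfolding P_def using assms(8) by (simp add: card_image)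
  have \<delta>: "\<delta> = 1 - (\<Sum>p\<in>P. 1 / real p)"
    unfolding assms(10) P_def using assms(8) by (simp add: sum.reindex)
  define c where "c = (real s - 1) / \<delta> + 2"
  have "c \<ge> 0"
  \<comment> \<open>For \<open>s = 0\<close> the sum is empty, so \<open>\<delta> = 1\<close> and
    \<open>c = 1\<close>; otherwise the fraction is nonnegative.\<close>
  proof (cases "s = 0")
    case True
    thus ?thesis using assms(10) by (simp add: c_def)
  next
    case False
    thus ?thesis using assms(11) by (simp add: c_def)
  qed
  have W: "2 ^ card (prime_factors k) \<le> real (W k)"
    using of_nat_mono[OF two_power_card_prime_factors_le_W[OF k], where 'a = real] by simp
  have "c * 2 ^ card (prime_factors k) \<le> c * real (W k)"
    using W \<open>c \<ge> 0\<close> by (rule mult_left_mono)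
  also have "\<dots> \<le> sqrt 2 * (c * real (W k))"
    using mult_right_mono[of 1 "sqrt 2" "c * real (W k)"] \<open>c \<ge> 0\<close> by simp
  also have "\<dots> < real q powr (real n / 2 - 1)"
    using assms(12) by (simp add: c_def mult.assoc)
  also have "\<dots> = sqrt (real q ^ (n - 2))"
  proof -
    have "real n / 2 - 1 = real (n - 2) * (1 / 2)" using assms(3) by (simp add: field_simps)
    hence "real q powr (real n / 2 - 1) = (real q powr real (n - 2)) powr (1 / 2)"
      by (simp only: powr_powr)
    also have "real q powr real (n - 2) = real q ^ (n - 2)"
      using F.q_gt_1 by (intro powr_realpow) simp
    finally show ?thesis by (simp add: powr_half_sqrt)
  qed
  finally have bound: "c * 2 ^ card (prime_factors k) < sqrt (real q ^ (n - 2))" .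
  have "F.free_count (prime_factors k \<union> P) > 0"
  proof (rule F.free_count_pos)
    show "P \<inter> prime_factors k = {}" using assms(9) by (auto simp: P_def)
    show "prime r \<and> r dvd F.Q" if "r \<in> prime_factors k \<union> P" for r
      using that assms(7,9) by (auto simp: P_def Q in_prime_factors_iff)
    show "((real (card P) - 1) / \<delta> + 2) * 2 ^ card (prime_factors k) < sqrt (real q ^ (n - 2))"
      using bound by (simp add: card_P c_def)
  qed (use \<delta> assms(11) P_def in auto)
  hence "{x \<in> F.H - {0}. \<forall>p\<in>prime_factors k \<union> P. \<not> p dvd F.dlog x} \<noteq> {}"
    unfolding F.free_count_def by (metis card.empty less_irrefl)
  then obtain y where y: "y \<in> F.H - {0}" "\<forall>p\<in>prime_factors k \<union> P. \<not> p dvd F.dlog y"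
    by blast
  \<comment> \<open>The two sieved sets together contain every prime factor of \<open>Q\<close>, by
    its given factorization.\<close>
  have "\<not> r dvd F.dlog y" if "r \<in> prime_factors F.Q" for r
  proof -
    have r: "prime r" "r dvd k * (\<Prod>i=1..s. p i)"
      using that assms(7) by (auto simp: Q in_prime_factors_iff)
    have "r \<in> prime_factors k \<union> P"
    proof (cases "r dvd k")
      case True
      thus ?thesis using r k by (simp add: in_prime_factors_iff)
    next
      case False
      then obtain i where i: "i \<in> {1..s}" "r dvd p i"
        using r by (auto simp: prime_dvd_mult_iff prime_dvd_prod_iff)
      hence "r = p i" using r(1) assms(9) by (auto intro: primes_dvd_imp_eq)
      thus ?thesis using i by (simp add: P_def)
    qed
    thus ?thesis using y(2) by blast
  qed
  from F.m_free_exists[OF \<open>odd F.Q\<close> y(1) this]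
  have "{\<xi>::'a. m_free (q ^ n - 1) \<xi> \<and> field_trace q n (\<xi>\<^sup>2) = 0} \<noteq> {}"
    by (auto simp: F.N_def)
  thus ?thesis by (simp add: N0_def card_gt_0_iff)
qed

end
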